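(* Let $\gamma:S^n\to\mathbb R_{>0}$ be of class $C^2$. Then the Cahn-Hoffman map $\xi=\xi_\gamma:S^n\to\mathbb R^{n+1}$ satisfies the following (i) and (ii), hence $\xi$ is a $C^1$-(wave)front. (i) $\langle(d\xi)_\nu(u),\nu\rangle=0$ for all $\nu\in S^n$ and all $u\in T_\nu S^n$. (ii) The mapping $(\xi,\mathrm{id}_{S^n}):S^n\to\mathbb R^{n+1}\times S^n$, $(\xi,\mathrm{id}_{S^n})(\nu)=(\xi(\nu),\nu)$, is a $C^1$-immersion.
   Context: $S^n$ is the unit sphere in $\mathbb R^{n+1}$. The Cahn-Hoffman map of $\gamma$ is $\xi_\gamma(\nu)=D\gamma|_\nu+\gamma(\nu)\nu$, where $D\gamma$ is the gradient of $\gamma$ on $S^n$ and $T_\nu S^n$ is regarded as a linear subspace of $\mathbb R^{n+1}$. A $C^1$ map $f$ from an $n$-manifold $N$ into $\mathbb R^{n+1}$ is a $C^1$-front if there is a map $\nu_f:N\to S^n$ with $\langle df(u),\nu_f\rangle=0$ for all tangent vectors $u$ such that $(f,\nu_f)$ is a $C^1$-immersion; here $\nu_f=\mathrm{id}_{S^n}$. *)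

theory Defs
  imports "HOL-Analysis.Analysis"
begin

text \<open>
  The space \<open>\<real>\<^sup>n\<^sup>+\<^sup>1\<close> is an arbitrary \<^typ>\<open>'a::euclidean_space\<close>, of dimension
  \<open>DIM('a) = n + 1\<close>, and \<open>S\<^sup>n\<close> is \<^term>\<open>sphere (0::'a::euclidean_space) 1\<close>.  A map on
  \<open>S\<^sup>n\<close> is a function on the whole type of which only the values on the sphere matter.
\<close>

text \<open>\<open>Ck_on\<close> is meant for open sets \<^term>\<open>U\<close>; the derivative is the full one,
  \<^term>\<open>at x\<close>.\<close>

primrec Ck_on ::
  "nat \<Rightarrow> ('a::real_normed_vector \<Rightarrow> 'b::real_normed_vector) \<Rightarrow> 'a set \<Rightarrow> bool" where
  "Ck_on 0 f U \<longleftrightarrow> continuous_on U f"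
| "Ck_on (Suc k) f U \<longleftrightarrow> (\<forall>x\<in>U. f differentiable (at x)) \<and>
     (\<forall>v. Ck_on k (\<lambda>x. frechet_derivative f (at x) v) U)"

text \<open>Class \<open>C\<^sup>k\<close> on a subset \<^term>\<open>M\<close> (in practice an embedded submanifold) of a Euclidean
  space: local extendability to a \<open>C\<^sup>k\<close> map on an open set of the ambient space.\<close>

definition Ck_map ::
  "nat \<Rightarrow> 'a::euclidean_space set \<Rightarrow> ('a \<Rightarrow> 'b::euclidean_space) \<Rightarrow> bool" where
  "Ck_map k M f \<longleftrightarrow>
     (\<forall>p\<in>M. \<exists>U F. open U \<and> p \<in> U \<and> Ck_on k F U \<and> (\<forall>x\<in>U \<inter> M. F x = f x))"

text \<open>The velocities at \<^term>\<open>p\<close> of the \<open>C\<^sup>1\<close> curves in \<^term>\<open>M\<close> through \<^term>\<open>p\<close>, as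
  vectors of the ambient space.\<close>

definition tangent_space :: "'a::euclidean_space set \<Rightarrow> 'a \<Rightarrow> 'a set" where
  "tangent_space M p = {u. \<exists>c e. 0 < e \<and> c C1_differentiable_on {-e<..<e} \<and>
     c ` {-e<..<e} \<subseteq> M \<and> c 0 = p \<and> (c has_vector_derivative u) (at 0)}"

text \<open>
  A derivative within \<^term>\<open>M\<close> is a linear map on the whole ambient space, and in general
  is not unique.  Its values on \<^term>\<open>tangent_space M p\<close>, the only ones used below, are
  determined (lemma \<open>differential_along_curve\<close>): they are the usual \<open>(df)\<^sub>p(u)\<close>.
\<close>

definition differential ::
  "'a::euclidean_space set \<Rightarrow> ('a \<Rightarrow> 'b::euclidean_space) \<Rightarrow> 'a \<Rightarrow> 'a \<Rightarrow> 'b" where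
  "differential M f p = frechet_derivative f (at p within M)"

text \<open>The gradient for the metric that \<^term>\<open>M\<close> inherits from the ambient space.\<close>

definition manifold_gradient ::
  "'a::euclidean_space set \<Rightarrow> ('a \<Rightarrow> real) \<Rightarrow> 'a \<Rightarrow> 'a" where
  "manifold_gradient M g p =
     (THE w. w \<in> tangent_space M p \<and>
        (\<forall>u\<in>tangent_space M p. w \<bullet> u = differential M g p u))"

definition cahn_hoffman :: "('a::euclidean_space \<Rightarrow> real) \<Rightarrow> 'a \<Rightarrow> 'a" where
  "cahn_hoffman \<gamma> \<nu> = manifold_gradient (sphere 0 1) \<gamma> \<nu> + \<gamma> \<nu> *\<^sub>R \<nu>"

text \<open>A \<open>C\<^sup>1\<close> immersion of \<^term>\<open>M\<close> into \<^term>\<open>N\<close>.  As \<^term>\<open>N\<close> is an embedded submanifold,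
  regularity and injectivity of the differential may be tested in the ambient space.\<close>

definition C1_immersion ::
  "'a::euclidean_space set \<Rightarrow> 'b::euclidean_space set \<Rightarrow> ('a \<Rightarrow> 'b) \<Rightarrow> bool" where
  "C1_immersion M N f \<longleftrightarrow> f ` M \<subseteq> N \<and> Ck_map 1 M f \<and>
     (\<forall>p\<in>M. inj_on (differential M f p) (tangent_space M p))"

text \<open>\<open>C\<^sup>1\<close> fronts \<open>N \<rightarrow> \<real>\<^sup>n\<^sup>+\<^sup>1\<close> whose domain is the \<open>n\<close>-manifold \<open>N = S\<^sup>n\<close>.\<close>

definition C1_front_sphere :: "('a::euclidean_space \<Rightarrow> 'a) \<Rightarrow> bool" where
  "C1_front_sphere f \<longleftrightarrow> Ck_map 1 (sphere 0 1) f \<and>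
     (\<exists>n. n ` sphere 0 1 \<subseteq> sphere 0 1 \<and>
        (\<forall>p\<in>sphere 0 1. \<forall>u\<in>tangent_space (sphere 0 1) p.
           differential (sphere 0 1) f p u \<bullet> n p = 0) \<and>
        C1_immersion (sphere 0 1) (UNIV \<times> sphere 0 1) (\<lambda>p. (f p, n p)))"

lemma differential_along_curve:
  fixes f :: "'a::euclidean_space \<Rightarrow> 'b::euclidean_space"
  assumes f: "f differentiable (at (c 0) within M)"
    and e: "0 < e" and cM: "c ` {-e<..<e} \<subseteq> M"
    and c: "(c has_vector_derivative u) (at 0)"
  shows "((\<lambda>t. f (c t)) has_vector_derivative differential M f (c 0) u) (at 0)"
proof -
  let ?I = "{-e<..<e}"
  have at0: "at 0 within ?I = at 0"
    using e by (intro at_within_open) auto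
  have D: "(f has_derivative differential M f (c 0)) (at (c 0) within M)"
    using f unfolding differential_def by (simp add: frechet_derivative_works)
  then have D': "(f has_derivative differential M f (c 0)) (at (c 0) within c ` ?I)"
    using cM by (rule has_derivative_subset)
  have "(c has_derivative (\<lambda>t. t *\<^sub>R u)) (at 0 within ?I)"
    using c unfolding at0 has_vector_derivative_def .
  from diff_chain_within[OF this D']
  have "(f \<circ> c has_derivative differential M f (c 0) \<circ> (\<lambda>t. t *\<^sub>R u)) (at 0)"
    unfolding at0 .
  moreover have "linear (differential M f (c 0))"
    using D by (rule has_derivative_linear)
  ultimately show ?thesis
    by (simp add: has_vector_derivative_def o_def linear_scale)
qed

lemma tangent_space_sphere:
  fixes p :: "'a::euclidean_space"
  assumes p: "p \<in> sphere 0 1"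
  shows "tangent_space (sphere 0 1) p = {u. u \<bullet> p = 0}"
proof (intro equalityI subsetI)
  fix u assume "u \<in> tangent_space (sphere 0 1) p"
  then obtain c e where e: "0 < e" and cM: "c ` {-e<..<e} \<subseteq> sphere 0 1"
    and c0: "c 0 = p" and c: "(c has_vector_derivative u) (at (0::real))"
    unfolding tangent_space_def by blast
  have cd: "(c has_derivative (\<lambda>t. t *\<^sub>R u)) (at 0)"
    using c by (simp add: has_vector_derivative_def)
  have 1: "((\<lambda>t. c t \<bullet> c t) has_derivative (\<lambda>t. c 0 \<bullet> (t *\<^sub>R u) + (t *\<^sub>R u) \<bullet> c 0)) (at 0)"
    by (rule has_derivative_inner[OF cd cd])
  have 2: "((\<lambda>t. c t \<bullet> c t) has_derivative (\<lambda>t. 0)) (at 0)"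
  proof (rule has_derivative_transform_within_open[where s = "{-e<..<e}"])
    show "((\<lambda>t. 1::real) has_derivative (\<lambda>t. 0)) (at 0)" by simp
    show "1 = c t \<bullet> c t" if "t \<in> {-e<..<e}" for t
    proof -
      have "norm (c t) = 1" using cM that by (auto simp: image_subset_iff)
      then show ?thesis by (simp add: norm_eq_1)
    qed
  qed (use e in auto)
  have "(\<lambda>t::real. c 0 \<bullet> (t *\<^sub>R u) + (t *\<^sub>R u) \<bullet> c 0) = (\<lambda>t. 0)"
    by (rule has_derivative_unique[OF 1 2])
  from fun_cong[OF this, of 1] show "u \<in> {u. u \<bullet> p = 0}"
    by (simp add: c0 inner_commute)
next
  fix u assume "u \<in> {u. u \<bullet> p = 0}"
  then have up: "u \<bullet> p = 0" by simp
  define c where "c = (\<lambda>t. cos (norm u * t) *\<^sub>R p + sin (norm u * t) *\<^sub>R sgn u)"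
  define c' where
    "c' = (\<lambda>t. (- sin (norm u * t) * norm u) *\<^sub>R p + (cos (norm u * t) * norm u) *\<^sub>R sgn u)"
  have der: "(c has_vector_derivative c' t) (at t)" for t
    unfolding c_def c'_def
    by (auto intro!: derivative_eq_intros simp: has_real_derivative_iff_has_vector_derivative[symmetric])
  have "continuous_on {-1<..<1} c'"
    unfolding c'_def by (intro continuous_intros)
  then have C1: "c C1_differentiable_on {-1<..<1}"
    unfolding C1_differentiable_on_def using der by blast
  have np: "p \<bullet> p = 1" using p by (simp add: norm_eq_1)
  have "c t \<in> sphere 0 1" for t
  proof (cases "u = 0")
    case True
    then show ?thesis using p by (simp add: c_def)
  next
    case False
    then have "sgn u \<bullet> sgn u = 1"
      by (simp add: norm_eq_1[symmetric] norm_sgn)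
    moreover have "p \<bullet> sgn u = 0" "sgn u \<bullet> p = 0"
      using up by (simp_all add: sgn_div_norm inner_commute)
    ultimately have "c t \<bullet> c t = 1"
      by (simp add: c_def inner_add_left inner_add_right np flip: power2_eq_square)
    then show ?thesis by (simp add: norm_eq_1)
  qed
  moreover have "c 0 = p" by (simp add: c_def)
  moreover have "c' 0 = u" by (cases "u = 0") (simp_all add: c'_def sgn_div_norm)
  ultimately show "u \<in> tangent_space (sphere 0 1) p"
    unfolding tangent_space_def using C1 der[of 0]
    by (auto intro!: exI[of _ c] exI[of _ "1::real"])
qed

end

theory Submission
  imports Defs
begin

text \<open>
  Near a point of the sphere, let \<open>F\<close> be a \<open>C\<^sup>2\<close> extension of \<open>\<gamma>\<close> to an open set of the ambient
  space, and let \<open>G\<close> be its Euclidean gradient, a \<open>C\<^sup>1\<close> field.  The gradient of \<open>\<gamma>\<close> on the sphere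
  at \<open>\<nu>\<close> is the tangential part \<open>G \<nu> - (G \<nu> \<bullet> \<nu>) \<nu>\<close> of \<open>G \<nu>\<close>, so the Cahn-Hoffman map is, near
  that point, the restriction of the \<open>C\<^sup>1\<close> map \<open>H x = G x + (F x - G x \<bullet> x) x\<close>
  (\<open>cahn_hoffman_eq_extension\<close>, \<open>Ck_on_cahn_hoffman_extension\<close>).

  Differentiating \<open>H\<close> at a unit vector \<open>\<nu>\<close> in a direction \<open>u\<close> orthogonal to \<open>\<nu>\<close>, and taking the
  inner product with \<open>\<nu>\<close>, the terms that contain the derivative of \<open>G\<close> cancel, and what is left is
  \<open>dF(u) - G \<nu> \<bullet> u\<close>, which vanishes because \<open>G\<close> is the gradient of \<open>F\<close>
  (\<open>cahn_hoffman_extension_derivative_orthogonal\<close>).  This is the tangency (i).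

  For (ii), the differential of \<open>\<nu> \<mapsto> (\<xi> \<nu>, \<nu>)\<close> is \<open>u \<mapsto> (d\<xi>(u), u)\<close>, whose second component makes
  it injective, however degenerate \<open>d\<xi>\<close> is (\<open>C1_immersion_graph\<close>).
\<close>

section \<open>Differentials of restrictions of ambient maps\<close>

text \<open>Any two derivatives within \<open>M\<close> agree on velocities of curves in \<open>M\<close>, by the chain rule.  So
  the choice made in \<^const>\<open>differential\<close> is harmless, and the differential can be computed from
  any derivative at hand.\<close>

lemma differential_eq:
  fixes f :: "'a::euclidean_space \<Rightarrow> 'b::euclidean_space"
  assumes D: "(f has_derivative D) (at p within M)" and u: "u \<in> tangent_space M p"
  shows "differential M f p u = D u"
proof -
  obtain c and e :: real where e: "0 < e" and cM: "c ` {-e<..<e} \<subseteq> M" and c0: "c 0 = p"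
    and c: "(c has_vector_derivative u) (at 0)"
    using u unfolding tangent_space_def by blast
  have at0: "at 0 within {-e<..<e} = at 0"
    using e by (intro at_within_open) auto
  have "(c has_derivative (\<lambda>t. t *\<^sub>R u)) (at 0 within {-e<..<e})"
    using c unfolding at0 has_vector_derivative_def .
  moreover have "(f has_derivative D) (at (c 0) within c ` {-e<..<e})"
    using D cM unfolding c0 by (rule has_derivative_subset)
  ultimately have "(f \<circ> c has_derivative D \<circ> (\<lambda>t. t *\<^sub>R u)) (at 0)"
    unfolding at0[symmetric] by (rule diff_chain_within)
  then have "((\<lambda>t. f (c t)) has_vector_derivative D u) (at 0)"
    using has_derivative_linear[OF D] by (simp add: has_vector_derivative_def o_def linear_scale)
  moreover have "((\<lambda>t. f (c t)) has_vector_derivative differential M f p u) (at 0)"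
    using differential_along_curve[OF _ e cM c] differentiableI[OF D] unfolding c0 by blast
  ultimately show ?thesis
    by (rule vector_derivative_unique_at[rotated])
qed

lemma has_derivative_within_of_extension:
  assumes "(F has_derivative D) (at p)" and "open U" and "p \<in> U" and "p \<in> M"
    and "\<forall>x\<in>U \<inter> M. F x = f x"
  shows "(f has_derivative D) (at p within M)"
proof (rule has_derivative_transform_eventually)
  show "(F has_derivative D) (at p within M)"
    using assms(1) by (rule has_derivative_at_withinI)
  show "\<forall>\<^sub>F x in at p within M. F x = f x"
    using assms(2,3,5) unfolding eventually_at_topological by blast
qed (use assms in auto)

lemma Ck_on_Suc_has_derivative:
  assumes "Ck_on (Suc k) F U" and "x \<in> U"
  shows "(F has_derivative frechet_derivative F (at x)) (at x)"
  using assms by (simp add: frechet_derivative_works)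

lemmas Ck_on_1_has_derivative = Ck_on_Suc_has_derivative[of 0, folded One_nat_def]

lemma Ck_on_Suc_continuous:
  assumes "Ck_on (Suc k) F U"
  shows "continuous_on U F"
  by (rule continuous_at_imp_continuous_on)
    (use assms in \<open>auto intro: differentiable_imp_continuous_within\<close>)

lemma Ck_on_1I:
  assumes D: "\<And>x. x \<in> U \<Longrightarrow> (F has_derivative F' x) (at x)"
    and cont: "\<And>v. continuous_on U (\<lambda>x. F' x v)"
  shows "Ck_on 1 F U"
proof -
  have "frechet_derivative F (at x) = F' x" if "x \<in> U" for x
    using frechet_derivative_at[OF D[OF that]] by simp
  then have "continuous_on U (\<lambda>x. frechet_derivative F (at x) v)" for v
    using cont[of v] by (simp cong: continuous_on_cong)
  then show ?thesis
    using D by (auto intro: differentiableI)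
qed

lemma Ck_map_1_differentiable:
  assumes "Ck_map 1 M f" and "p \<in> M"
  shows "f differentiable (at p within M)"
proof -
  obtain U F where U: "open U" "p \<in> U" and F: "Ck_on 1 F U" and eq: "\<forall>x\<in>U \<inter> M. F x = f x"
    using assms unfolding Ck_map_def by blast
  show ?thesis
    by (rule differentiableI)
      (rule has_derivative_within_of_extension[OF Ck_on_1_has_derivative[OF F U(2)] U assms(2) eq])
qed

text \<open>The differential of \<open>p \<mapsto> (f p, p)\<close> is \<open>u \<mapsto> (df(u), u)\<close>, which is injective.\<close>

lemma C1_immersion_graph:
  fixes f :: "'a::euclidean_space \<Rightarrow> 'b::euclidean_space"
  assumes f: "Ck_map 1 M f"
  shows "C1_immersion M (UNIV \<times> M) (\<lambda>p. (f p, p))"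
  unfolding C1_immersion_def
proof (intro conjI ballI)
  show "Ck_map 1 M (\<lambda>p. (f p, p))"
    unfolding Ck_map_def
  proof
    fix p assume "p \<in> M"
    then obtain U F where U: "open U" "p \<in> U" and F: "Ck_on 1 F U"
      and eq: "\<forall>x\<in>U \<inter> M. F x = f x"
      using f unfolding Ck_map_def by blast
    have "Ck_on 1 (\<lambda>x. (F x, x)) U"
    proof (rule Ck_on_1I)
      show "((\<lambda>x. (F x, x)) has_derivative (\<lambda>v. (frechet_derivative F (at x) v, v))) (at x)"
        if "x \<in> U" for x
        by (rule has_derivative_Pair[OF Ck_on_1_has_derivative[OF F that] has_derivative_ident])
      show "continuous_on U (\<lambda>x. (frechet_derivative F (at x) v, v))" for v
        using F by (intro continuous_intros) simp
    qed
    then show "\<exists>U F. open U \<and> p \<in> U \<and> Ck_on 1 F U \<and> (\<forall>x\<in>U \<inter> M. F x = (f x, x))"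
      using U eq by (intro exI[of _ U] exI[of _ "\<lambda>x. (F x, x)"]) auto
  qed
  fix p assume "p \<in> M"
  then have "(f has_derivative differential M f p) (at p within M)"
    unfolding differential_def frechet_derivative_works[symmetric]
    by (rule Ck_map_1_differentiable[OF f])
  then have "((\<lambda>p. (f p, p)) has_derivative (\<lambda>u. (differential M f p u, u))) (at p within M)"
    by (intro has_derivative_Pair has_derivative_ident)
  from differential_eq[OF this]
  show "inj_on (differential M (\<lambda>p. (f p, p)) p) (tangent_space M p)"
    by (auto intro!: inj_onI)
qed auto

section \<open>The Cahn-Hoffman map in ambient terms\<close>

definition ambient_gradient :: "('a::euclidean_space \<Rightarrow> real) \<Rightarrow> 'a \<Rightarrow> 'a" where
  "ambient_gradient F x = (\<Sum>b\<in>Basis. frechet_derivative F (at x) b *\<^sub>R b)"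

lemma ambient_gradient_inner:
  assumes "F differentiable (at x)"
  shows "ambient_gradient F x \<bullet> u = frechet_derivative F (at x) u"
proof -
  have lin: "linear (frechet_derivative F (at x))"
    using assms by (rule linear_frechet_derivative)
  have "ambient_gradient F x \<bullet> u = (\<Sum>b\<in>Basis. (u \<bullet> b) * frechet_derivative F (at x) b)"
    by (simp add: ambient_gradient_def inner_sum_left inner_commute[of u] mult.commute)
  also have "\<dots> = frechet_derivative F (at x) (\<Sum>b\<in>Basis. (u \<bullet> b) *\<^sub>R b)"
    using lin by (simp add: linear_sum linear_scale)
  finally show ?thesis
    by (simp add: euclidean_representation)
qed

text \<open>On the unit sphere this is the tangential part of the gradient plus \<open>F x\<close> times the normal
  \<open>x\<close>.  Off the sphere no normalisation of \<open>x\<close> is made: any \<open>C\<^sup>1\<close> extension will do, and a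
  polynomial expression in \<open>x\<close> is the easiest to differentiate.\<close>

definition cahn_hoffman_extension :: "('a::euclidean_space \<Rightarrow> real) \<Rightarrow> 'a \<Rightarrow> 'a" where
  "cahn_hoffman_extension F x =
     ambient_gradient F x + (F x - ambient_gradient F x \<bullet> x) *\<^sub>R x"

text \<open>The tangential part of the ambient gradient represents \<open>d\<gamma>\<close> on the tangent space; it is the
  only tangent vector that does, because a tangent vector orthogonal to the tangent space is
  zero.\<close>

lemma manifold_gradient_sphere:
  fixes F \<gamma> :: "'a::euclidean_space \<Rightarrow> real"
  assumes \<nu>: "\<nu> \<in> sphere 0 1" and F: "F differentiable (at \<nu>)"
    and U: "open U" "\<nu> \<in> U" and eq: "\<forall>x\<in>U \<inter> sphere 0 1. F x = \<gamma> x"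
  shows "manifold_gradient (sphere 0 1) \<gamma> \<nu> =
    ambient_gradient F \<nu> - (ambient_gradient F \<nu> \<bullet> \<nu>) *\<^sub>R \<nu>"
  unfolding manifold_gradient_def
proof (rule the_equality)
  let ?G = "ambient_gradient F \<nu>"
  let ?w = "?G - (?G \<bullet> \<nu>) *\<^sub>R \<nu>"
  have T: "tangent_space (sphere 0 1) \<nu> = {u. u \<bullet> \<nu> = 0}"
    using \<nu> by (rule tangent_space_sphere)
  have unit: "\<nu> \<bullet> \<nu> = 1"
    using \<nu> by (simp add: norm_eq_1)
  have "(\<gamma> has_derivative frechet_derivative F (at \<nu>)) (at \<nu> within sphere 0 1)"
    using has_derivative_within_of_extension[OF _ U \<nu> eq] F frechet_derivative_works by blast
  then have d\<gamma>: "differential (sphere 0 1) \<gamma> \<nu> u = ?G \<bullet> u"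
    if "u \<in> tangent_space (sphere 0 1) \<nu>" for u
    using that F by (simp add: differential_eq ambient_gradient_inner)
  show w: "?w \<in> tangent_space (sphere 0 1) \<nu> \<and>
    (\<forall>u\<in>tangent_space (sphere 0 1) \<nu>. ?w \<bullet> u = differential (sphere 0 1) \<gamma> \<nu> u)"
    using d\<gamma> unfolding T by (auto simp: inner_diff_left inner_diff_right unit inner_commute)
  fix w' assume w': "w' \<in> tangent_space (sphere 0 1) \<nu> \<and>
    (\<forall>u\<in>tangent_space (sphere 0 1) \<nu>. w' \<bullet> u = differential (sphere 0 1) \<gamma> \<nu> u)"
  have tang: "w' - ?w \<in> tangent_space (sphere 0 1) \<nu>"
    using w w' unfolding T by (simp add: inner_diff_left)
  have "(w' - ?w) \<bullet> (w' - ?w) = w' \<bullet> (w' - ?w) - ?w \<bullet> (w' - ?w)"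
    by (rule inner_diff_left)
  also have "\<dots> = 0"
    using w w' tang by (metis diff_self)
  finally show "w' = ?w"
    by simp
qed

lemma cahn_hoffman_eq_extension:
  fixes F \<gamma> :: "'a::euclidean_space \<Rightarrow> real"
  assumes "\<nu> \<in> sphere 0 1" and "F differentiable (at \<nu>)"
    and "open U" and "\<nu> \<in> U" and "\<forall>x\<in>U \<inter> sphere 0 1. F x = \<gamma> x"
  shows "cahn_hoffman \<gamma> \<nu> = cahn_hoffman_extension F \<nu>"
proof -
  have "F \<nu> = \<gamma> \<nu>"
    using assms by blast
  then show ?thesis
    unfolding cahn_hoffman_def cahn_hoffman_extension_def manifold_gradient_sphere[OF assms]
    by (simp add: algebra_simps)
qed

section \<open>Regularity and tangency\<close>

lemma has_derivative_cahn_hoffman_extension: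
  assumes F: "(F has_derivative F') (at x)"
    and G: "(ambient_gradient F has_derivative G') (at x)"
  shows "(cahn_hoffman_extension F has_derivative
    (\<lambda>v. G' v + (F' v - (G' v \<bullet> x + ambient_gradient F x \<bullet> v)) *\<^sub>R x
            + (F x - ambient_gradient F x \<bullet> x) *\<^sub>R v)) (at x)"
  unfolding cahn_hoffman_extension_def
  by (rule derivative_eq_intros F G refl ext)+ (simp add: algebra_simps)

lemma Ck_on_ambient_gradient:
  fixes F :: "'a::euclidean_space \<Rightarrow> real"
  assumes F: "Ck_on 2 F U"
  shows "Ck_on 1 (ambient_gradient F) U"
proof (rule Ck_on_1I)
  let ?D = "\<lambda>b y. frechet_derivative F (at y) b"
  have C1: "Ck_on (Suc 0) (?D b) U" for b
    using F by (simp add: numeral_2_eq_2)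
  show "(ambient_gradient F has_derivative
      (\<lambda>v. \<Sum>b\<in>Basis. frechet_derivative (?D b) (at x) v *\<^sub>R b)) (at x)" if "x \<in> U" for x
    unfolding ambient_gradient_def
    by (intro has_derivative_sum has_derivative_scaleR_left Ck_on_Suc_has_derivative[OF C1 that])
  show "continuous_on U (\<lambda>x. \<Sum>b\<in>Basis. frechet_derivative (?D b) (at x) v *\<^sub>R b)" for v
    using C1 by (intro continuous_intros) simp
qed

lemma Ck_on_cahn_hoffman_extension:
  fixes F :: "'a::euclidean_space \<Rightarrow> real"
  assumes F: "Ck_on 2 F U"
  shows "Ck_on 1 (cahn_hoffman_extension F) U"
proof (rule Ck_on_1I)
  have F2: "Ck_on (Suc (Suc 0)) F U"
    using F by (simp add: numeral_2_eq_2)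
  have G1: "Ck_on (Suc 0) (ambient_gradient F) U"
    using Ck_on_ambient_gradient[OF F] by simp
  show "(cahn_hoffman_extension F has_derivative
    (\<lambda>v. frechet_derivative (ambient_gradient F) (at x) v
       + (frechet_derivative F (at x) v - (frechet_derivative (ambient_gradient F) (at x) v \<bullet> x
            + ambient_gradient F x \<bullet> v)) *\<^sub>R x
       + (F x - ambient_gradient F x \<bullet> x) *\<^sub>R v)) (at x)" if "x \<in> U" for x
    using that
    by (intro has_derivative_cahn_hoffman_extension Ck_on_Suc_has_derivative[OF F2]
        Ck_on_Suc_has_derivative[OF G1])
  have "continuous_on U (\<lambda>x. frechet_derivative F (at x) v)" for v
    using F2 Ck_on_Suc_continuous[of 0 "\<lambda>x. frechet_derivative F (at x) v"]
    unfolding Ck_on.simps(2)[of "Suc 0"] by blast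
  then show "continuous_on U (\<lambda>x. frechet_derivative (ambient_gradient F) (at x) v
       + (frechet_derivative F (at x) v - (frechet_derivative (ambient_gradient F) (at x) v \<bullet> x
            + ambient_gradient F x \<bullet> v)) *\<^sub>R x
       + (F x - ambient_gradient F x \<bullet> x) *\<^sub>R v)" for v
    using G1 Ck_on_Suc_continuous[OF F2] Ck_on_Suc_continuous[OF G1]
    by (intro continuous_intros) simp_all
qed

text \<open>Write \<open>G\<close> for the gradient of \<open>F\<close>.  In the derivative at \<open>\<nu>\<close> along \<open>u\<close>, the normal component
  of \<open>dG(u)\<close> is cancelled by the term \<open>- (dG(u) \<bullet> \<nu>) \<nu>\<close>, the multiples of \<open>u\<close> are tangent, and
  the remaining normal part is \<open>dF(u) - G \<nu> \<bullet> u = 0\<close>.\<close>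

lemma cahn_hoffman_extension_derivative_orthogonal:
  fixes F :: "'a::euclidean_space \<Rightarrow> real"
  assumes F: "F differentiable (at \<nu>)" and G: "ambient_gradient F differentiable (at \<nu>)"
    and unit: "\<nu> \<bullet> \<nu> = 1" and u: "u \<bullet> \<nu> = 0"
  shows "frechet_derivative (cahn_hoffman_extension F) (at \<nu>) u \<bullet> \<nu> = 0"
proof -
  have "(cahn_hoffman_extension F has_derivative
    (\<lambda>v. frechet_derivative (ambient_gradient F) (at \<nu>) v
       + (frechet_derivative F (at \<nu>) v - (frechet_derivative (ambient_gradient F) (at \<nu>) v \<bullet> \<nu>
            + ambient_gradient F \<nu> \<bullet> v)) *\<^sub>R \<nu>
       + (F \<nu> - ambient_gradient F \<nu> \<bullet> \<nu>) *\<^sub>R v)) (at \<nu>)"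
    using F G
    by (intro has_derivative_cahn_hoffman_extension) (simp_all add: frechet_derivative_works)
  from frechet_derivative_at[OF this, symmetric] show ?thesis
    by (simp add: inner_add_left inner_diff_left unit u ambient_gradient_inner[OF F])
qed

text \<open>Such an \<open>H\<close> gives both regularity and differential of the Cahn-Hoffman map at \<open>\<nu>\<close>, because it
  agrees with that map on a whole relative neighbourhood of \<open>\<nu>\<close>: one \<open>C\<^sup>2\<close> extension of \<open>\<gamma>\<close>
  computes the gradient of \<open>\<gamma>\<close> at every nearby point of the sphere.\<close>

lemma cahn_hoffman_local_extension:
  fixes \<gamma> :: "'a::euclidean_space \<Rightarrow> real"
  assumes \<gamma>: "Ck_map 2 (sphere 0 1) \<gamma>" and \<nu>: "\<nu> \<in> sphere 0 1"
  obtains U H where "open U" and "\<nu> \<in> U" and "Ck_on 1 H U"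
    and "\<forall>x\<in>U \<inter> sphere 0 1. H x = cahn_hoffman \<gamma> x"
    and "\<And>u. u \<bullet> \<nu> = 0 \<Longrightarrow> frechet_derivative H (at \<nu>) u \<bullet> \<nu> = 0"
proof -
  obtain U F where U: "open U" "\<nu> \<in> U" and F: "Ck_on 2 F U"
    and eq: "\<forall>x\<in>U \<inter> sphere 0 1. F x = \<gamma> x"
    using \<gamma> \<nu> unfolding Ck_map_def by blast
  have dF: "F differentiable (at x)" if "x \<in> U" for x
    using F that by (simp add: numeral_2_eq_2)
  have dG: "ambient_gradient F differentiable (at \<nu>)"
    using Ck_on_ambient_gradient[OF F] U by simp
  show thesis
  proof (rule that[OF U Ck_on_cahn_hoffman_extension[OF F]])
    show "\<forall>x\<in>U \<inter> sphere 0 1. cahn_hoffman_extension F x = cahn_hoffman \<gamma> x"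
      using cahn_hoffman_eq_extension[OF _ dF U(1) _ eq] by auto
    show "frechet_derivative (cahn_hoffman_extension F) (at \<nu>) u \<bullet> \<nu> = 0" if "u \<bullet> \<nu> = 0" for u
      using cahn_hoffman_extension_derivative_orthogonal[OF dF[OF U(2)] dG _ that] \<nu>
      by (simp add: norm_eq_1)
  qed
qed

theorem proposition5p1:
  fixes \<gamma> :: "'a::euclidean_space \<Rightarrow> real"
  assumes "\<forall>\<nu>\<in>sphere 0 1. \<gamma> \<nu> > 0"
    and "Ck_map 2 (sphere 0 1) \<gamma>"
  shows "(\<forall>\<nu>\<in>sphere 0 1. \<forall>u\<in>tangent_space (sphere 0 1) \<nu>.
            differential (sphere 0 1) (cahn_hoffman \<gamma>) \<nu> u \<bullet> \<nu> = 0)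
       \<and> C1_immersion (sphere 0 1) (UNIV \<times> sphere 0 1) (\<lambda>\<nu>. (cahn_hoffman \<gamma> \<nu>, \<nu>))
       \<and> C1_front_sphere (cahn_hoffman \<gamma>)"
proof -
  have tangency: "\<forall>\<nu>\<in>sphere 0 1. \<forall>u\<in>tangent_space (sphere 0 1) \<nu>.
            differential (sphere 0 1) (cahn_hoffman \<gamma>) \<nu> u \<bullet> \<nu> = 0"
  proof (intro ballI)
    fix \<nu> u :: 'a
    assume \<nu>: "\<nu> \<in> sphere 0 1" and u: "u \<in> tangent_space (sphere 0 1) \<nu>"
    obtain U H where U: "open U" "\<nu> \<in> U" and H: "Ck_on 1 H U"
      and eq: "\<forall>x\<in>U \<inter> sphere 0 1. H x = cahn_hoffman \<gamma> x"
      and orth: "\<And>u. u \<bullet> \<nu> = 0 \<Longrightarrow> frechet_derivative H (at \<nu>) u \<bullet> \<nu> = 0"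
      using cahn_hoffman_local_extension[OF assms(2) \<nu>] by blast
    from has_derivative_within_of_extension[OF Ck_on_1_has_derivative[OF H U(2)] U \<nu> eq]
    have "differential (sphere 0 1) (cahn_hoffman \<gamma>) \<nu> u = frechet_derivative H (at \<nu>) u"
      using u by (rule differential_eq)
    then show "differential (sphere 0 1) (cahn_hoffman \<gamma>) \<nu> u \<bullet> \<nu> = 0"
      using orth u tangent_space_sphere[OF \<nu>] by simp
  qed
  have C1: "Ck_map 1 (sphere 0 1) (cahn_hoffman \<gamma>)"
    unfolding Ck_map_def
    by (meson cahn_hoffman_local_extension[OF assms(2)])
  have immersion:
    "C1_immersion (sphere 0 1) (UNIV \<times> sphere 0 1) (\<lambda>\<nu>. (cahn_hoffman \<gamma> \<nu>, \<nu>))"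
    using C1 by (rule C1_immersion_graph)
  have "C1_front_sphere (cahn_hoffman \<gamma>)"
    unfolding C1_front_sphere_def
    using C1 tangency immersion by (intro conjI exI[of _ "\<lambda>\<nu>. \<nu>"]) auto
  with tangency immersion show ?thesis
    by blast
qed

end
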